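(* Let $d\ge 2$, let $F(X)=X^d+a_1X^{d-1}+\cdots+a_d\in\mathbb{Z}[X]$ be monic and irreducible, and let $\alpha$ be a root of $F$. (i) Let $I\subset\mathbb{Z}[\alpha]$ be a nonzero ideal such that the additive group $\mathbb{Z}[\alpha]/I$ is cyclic. Then there exist a positive integer $m$ and an integer $\mu$ with $F(\mu)\equiv 0\pmod m$ such that $$\{\alpha^{d-1}-\mu^{d-1},\ \alpha^{d-2}-\mu^{d-2},\ \dots,\ \alpha-\mu,\ m\}$$ is a $\mathbb{Z}$-basis of $I$ (equivalently, $I$ has the basis $(\beta_1,\dots,\beta_d)^T=R\,(\alpha^{d-1},\dots,\alpha,1)^T$ where $R$ is the $d\times d$ matrix with the identity in the upper-left $(d-1)\times(d-1)$ block, last column $(-\mu^{d-1},\dots,-\mu,m)^T$, and zeros elsewhere). Moreover $m$ and the residue class $\mu \bmod m$ are uniquely determined by $I$. (ii) Conversely, given a positive integer $m$ and an integer $\mu$ with $F(\mu)\equiv 0\pmod m$, the sublattice $I$ of $\mathbb{Z}[\alpha]$ with $\mathbb{Z}$-basis $\{\alpha^{d-1}-\mu^{d-1},\dots,\alpha-\mu,m\}$ is an ideal of $\mathbb{Z}[\alpha]$ such that $\mathbb{Z}[\alpha]/I$ is additively cyclic. *)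

theory Defs
  imports
    "HOL-Computational_Algebra.Polynomial_Factorial"
    "HOL-Number_Theory.Cong"
    "HOL-Algebra.QuotRing"
    "HOL-Algebra.Elementary_Groups"
    "Jordan_Normal_Form.Matrix"
begin

text \<open>The ring \<open>\<int>[\<alpha>]\<close>: the image of \<open>\<int>[X]\<close> under evaluation at \<open>\<alpha>\<close>, with the operations
  of the ambient field.\<close>

definition int_adjoin :: "'a::field_char_0 \<Rightarrow> 'a ring" where
  "int_adjoin \<alpha> = \<lparr>carrier = range (\<lambda>p. poly (map_poly of_int p) \<alpha>),
     monoid.mult = (*), one = 1, zero = 0, add = (+)\<rparr>"

lemma cring_int_adjoin: "cring (int_adjoin \<alpha>)"
proof -
  let ?ev = "\<lambda>p. poly (map_poly of_int p) \<alpha>"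
  have ev: "?ev (p + q) = ?ev p + ?ev q" "?ev (p * q) = ?ev p * ?ev q" "?ev (- p) = - ?ev p"
      "?ev 1 = 1" "?ev 0 = 0" for p q
  proof -
    have "map_poly of_int (p + q) = (map_poly of_int p + map_poly of_int q :: 'a poly)"
      by (rule poly_eqI) (simp add: coeff_map_poly)
    then show "?ev (p + q) = ?ev p + ?ev q" by simp
    have "map_poly of_int (p * q) = (map_poly of_int p * map_poly of_int q :: 'a poly)"
      by (rule poly_eqI) (simp add: coeff_map_poly coeff_mult)
    then show "?ev (p * q) = ?ev p * ?ev q" by simp
    have "map_poly of_int (- p) = (- map_poly of_int p :: 'a poly)"
      by (rule poly_eqI) (simp add: coeff_map_poly)
    then show "?ev (- p) = - ?ev p" by simp
  qed simp_all
  have closed: "1 \<in> range ?ev" "0 \<in> range ?ev"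
    "x \<in> range ?ev \<Longrightarrow> y \<in> range ?ev \<Longrightarrow> x + y \<in> range ?ev"
    "x \<in> range ?ev \<Longrightarrow> y \<in> range ?ev \<Longrightarrow> x * y \<in> range ?ev"
    "x \<in> range ?ev \<Longrightarrow> - x \<in> range ?ev" for x y
  proof -
    show "1 \<in> range ?ev" "0 \<in> range ?ev"
      by (rule range_eqI, rule ev(4)[symmetric], rule range_eqI, rule ev(5)[symmetric])
    show "x + y \<in> range ?ev" if "x \<in> range ?ev" "y \<in> range ?ev"
      using that ev(1)[symmetric] by auto
    show "x * y \<in> range ?ev" if "x \<in> range ?ev" "y \<in> range ?ev"
      using that ev(2)[symmetric] by auto
    show "- x \<in> range ?ev" if "x \<in> range ?ev"
      using that ev(3)[symmetric] by auto
  qed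
  show ?thesis
    unfolding int_adjoin_def
  proof (rule cringI)
    show "abelian_group \<lparr>carrier = range ?ev, monoid.mult = (*), one = 1, zero = 0, add = (+)\<rparr>"
    proof (rule abelian_groupI, goal_cases)
      case (6 x)
      then have "- x \<in> range ?ev" using closed(5) by simp
      then show ?case unfolding partial_object.simps ring.simps by (rule bexI[rotated]) simp
    qed (auto simp: add_ac intro: closed)
    show "comm_monoid \<lparr>carrier = range ?ev, monoid.mult = (*), one = 1, zero = 0, add = (+)\<rparr>"
      by (rule comm_monoidI) (auto simp: mult_ac intro: closed)
  qed (auto simp: distrib_right)
qed

text \<open>The \<open>\<int>\<close>-module structure. The qualifier \<open>Modules\<close> is needed because
  \<open>module\<close> on its own denotes the locale of HOL-Algebra.\<close>

definition int_scale :: "int \<Rightarrow> 'a::ring_1 \<Rightarrow> 'a" where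
  "int_scale n x = of_int n * x"

lemma module_int_scale: "Modules.module int_scale"
  by unfold_locales (simp_all add: int_scale_def algebra_simps)

definition int_span :: "'a::ring_1 set \<Rightarrow> 'a set" where
  "int_span = Modules.module.span int_scale"

text \<open>The family \<open>b 0, \<dots>, b (d - 1)\<close> is a \<open>\<int>\<close>-basis of \<open>M\<close>; injectivity excludes a family with
  repetitions, which the independence of the underlying set alone would not.\<close>

definition is_int_basis :: "nat \<Rightarrow> (nat \<Rightarrow> 'a::ring_1) \<Rightarrow> 'a set \<Rightarrow> bool" where
  "is_int_basis d b M \<longleftrightarrow> inj_on b {..<d} \<and>
     \<not> Modules.module.dependent int_scale (b ` {..<d}) \<and> int_span (b ` {..<d}) = M"

text \<open>The family \<open>\<alpha>^(d - 1) - \<mu>^(d - 1), \<dots>, \<alpha> - \<mu>, m\<close>, indexed from \<open>0\<close>.\<close>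

definition root_basis :: "nat \<Rightarrow> 'a::field_char_0 \<Rightarrow> int \<Rightarrow> int \<Rightarrow> nat \<Rightarrow> 'a" where
  "root_basis d \<alpha> m \<mu> i =
     (if i < d - 1 then \<alpha> ^ (d - 1 - i) - of_int \<mu> ^ (d - 1 - i) else of_int m)"

definition root_matrix :: "nat \<Rightarrow> int \<Rightarrow> int \<Rightarrow> int mat" where
  "root_matrix d m \<mu> = mat d d (\<lambda>(i, j).
     if j < d - 1 then (if i = j then 1 else 0)
     else if i < d - 1 then - (\<mu> ^ (d - 1 - i)) else m)"

definition power_vec :: "nat \<Rightarrow> 'a::field_char_0 \<Rightarrow> 'a vec" where
  "power_vec d \<alpha> = vec d (\<lambda>j. \<alpha> ^ (d - 1 - j))"

definition matrix_basis :: "nat \<Rightarrow> 'a::field_char_0 \<Rightarrow> int \<Rightarrow> int \<Rightarrow> nat \<Rightarrow> 'a" where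
  "matrix_basis d \<alpha> m \<mu> i = (map_mat of_int (root_matrix d m \<mu>) *\<^sub>v power_vec d \<alpha>) $ i"

end

theory Submission
  imports Defs
begin

text \<open>The lattice with basis \<open>\<alpha>^(d - 1) - \<mu>^(d - 1), \<dots>, \<alpha> - \<mu>, m\<close> is
  \<open>{p(\<alpha>) | m divides p(\<mu>)}\<close>: reduce \<open>p\<close> modulo the monic \<open>F\<close> and expand around \<open>\<mu>\<close>. In this
  form it is visibly an ideal whose quotient is generated by \<open>1\<close>. Conversely, if \<open>\<int>[\<alpha>]/I\<close> is
  additively cyclic, then \<open>1\<close> generates it, so \<open>\<alpha> \<equiv> \<mu>\<close> modulo \<open>I\<close> for some integer \<open>\<mu>\<close>;
  with \<open>m\<close> the positive generator of \<open>I \<inter> \<int>\<close>, an element \<open>p(\<alpha>) \<equiv> p(\<mu>)\<close> lies in \<open>I\<close> iff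
  \<open>m\<close> divides \<open>p(\<mu>)\<close>.\<close>

section \<open>Evaluation of integer polynomials\<close>

definition int_eval :: "'a::field_char_0 \<Rightarrow> int poly \<Rightarrow> 'a" where
  "int_eval \<alpha> p = poly (map_poly of_int p) \<alpha>"

lemma int_eval_sum_coeff: "int_eval \<alpha> p = (\<Sum>k\<le>degree p. of_int (coeff p k) * \<alpha> ^ k)"
  unfolding int_eval_def
  by (subst poly_altdef, subst degree_map_poly) (auto simp: coeff_map_poly)

lemma int_eval_0 [simp]: "int_eval \<alpha> 0 = 0"
  by (simp add: int_eval_def)

lemma int_eval_1 [simp]: "int_eval \<alpha> 1 = 1"
  by (simp add: int_eval_def)

lemma int_eval_add [simp]: "int_eval \<alpha> (p + q) = int_eval \<alpha> p + int_eval \<alpha> q"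
proof -
  have "map_poly of_int (p + q) = (map_poly of_int p + map_poly of_int q :: 'a poly)"
    by (rule poly_eqI) (simp add: coeff_map_poly)
  then show ?thesis by (simp add: int_eval_def)
qed

lemma int_eval_mult [simp]: "int_eval \<alpha> (p * q) = int_eval \<alpha> p * int_eval \<alpha> q"
proof -
  have "map_poly of_int (p * q) = (map_poly of_int p * map_poly of_int q :: 'a poly)"
    by (rule poly_eqI) (simp add: coeff_map_poly coeff_mult)
  then show ?thesis by (simp add: int_eval_def)
qed

lemma int_eval_const [simp]: "int_eval \<alpha> [:n:] = of_int n"
  by (simp add: int_eval_def map_poly_pCons)

lemma int_eval_monom [simp]: "int_eval \<alpha> (monom n k) = of_int n * \<alpha> ^ k"
  by (simp add: int_eval_def map_poly_monom poly_monom)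

lemma int_eval_smult [simp]: "int_eval \<alpha> (Polynomial.smult n p) = of_int n * int_eval \<alpha> p"
  using int_eval_mult[of \<alpha> "[:n:]" p] by simp

lemma int_eval_uminus [simp]: "int_eval \<alpha> (- p) = - int_eval \<alpha> p"
  using int_eval_smult[of \<alpha> "-1" p] by simp

lemma int_eval_diff [simp]: "int_eval \<alpha> (p - q) = int_eval \<alpha> p - int_eval \<alpha> q"
  using int_eval_add[of \<alpha> p "- q"] by simp

lemma int_eval_sum [simp]: "int_eval \<alpha> (sum f A) = (\<Sum>x\<in>A. int_eval \<alpha> (f x))"
  by (induction A rule: infinite_finite_induct) auto

section \<open>The ring generated by an element and its cyclic quotients\<close>

lemma int_adjoin_simps [simp]:
  "carrier (int_adjoin \<alpha>) = range (int_eval \<alpha>)"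
  "x \<otimes>\<^bsub>int_adjoin \<alpha>\<^esub> y = x * y" "\<one>\<^bsub>int_adjoin \<alpha>\<^esub> = 1"
  "x \<oplus>\<^bsub>int_adjoin \<alpha>\<^esub> y = x + y" "\<zero>\<^bsub>int_adjoin \<alpha>\<^esub> = 0"
  by (simp_all add: int_adjoin_def int_eval_def)

lemma ring_int_adjoin: "ring (int_adjoin \<alpha>)"
  using cring_int_adjoin by (rule cring.axioms(1))

lemma abelian_group_int_adjoin: "abelian_group (int_adjoin \<alpha>)"
  using ring_int_adjoin by (rule ring.is_abelian_group)

text \<open>Cyclicity of the quotient is phrased through powers in an additive group; this turns
  them into integer multiples in the ambient field.\<close>

lemma int_adjoin_additive_pow:
  assumes "x \<in> carrier (int_adjoin \<alpha>)"
  shows "x [^]\<^bsub>add_monoid (int_adjoin \<alpha>)\<^esub> (n :: int) = of_int n * x"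
proof -
  interpret G: group "add_monoid (int_adjoin \<alpha>)"
    by (rule abelian_group.a_group[OF abelian_group_int_adjoin])
  have nat: "x [^]\<^bsub>add_monoid (int_adjoin \<alpha>)\<^esub> (k :: nat) = of_nat k * x" for k
    by (induction k) (simp_all add: algebra_simps)
  have inv: "inv\<^bsub>add_monoid (int_adjoin \<alpha>)\<^esub> (int_eval \<alpha> p) = - int_eval \<alpha> p" for p
    by (rule G.inv_equality) (auto intro: range_eqI[of _ _ "- p"])
  obtain p where p: "x = int_eval \<alpha> p"
    using assms by auto
  show ?thesis
  proof (cases "n < 0")
    case True
    have "x [^]\<^bsub>add_monoid (int_adjoin \<alpha>)\<^esub> n = inv\<^bsub>add_monoid (int_adjoin \<alpha>)\<^esub> (of_nat (nat (- n)) * x)"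
      by (simp only: int_pow_def2 True if_True nat)
    also have "\<dots> = inv\<^bsub>add_monoid (int_adjoin \<alpha>)\<^esub> (int_eval \<alpha> (Polynomial.smult (- n) p))"
      using True by (simp add: p)
    also have "\<dots> = of_int n * x"
      by (subst inv) (simp add: p)
    finally show ?thesis .
  next
    case False
    then show ?thesis by (simp only: int_pow_def2 if_False nat) simp
  qed
qed

context
  fixes I :: "'a::field_char_0 set" and \<alpha> :: 'a
  assumes I: "ideal I (int_adjoin \<alpha>)"
begin

lemma ideal_int_adjoin_subset: "x \<in> I \<Longrightarrow> \<exists>p. x = int_eval \<alpha> p"
  using ideal.Icarr[OF I] by auto

lemma ideal_int_adjoin_zero: "0 \<in> I"
  using additive_subgroup.zero_closed[OF ideal.axioms(1)[OF I]] by simp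

lemma ideal_int_adjoin_add: "x \<in> I \<Longrightarrow> y \<in> I \<Longrightarrow> x + y \<in> I"
  using additive_subgroup.a_closed[OF ideal.axioms(1)[OF I]] by simp

lemma ideal_int_adjoin_mult: "x \<in> I \<Longrightarrow> int_eval \<alpha> p * x \<in> I"
  using ideal.I_l_closed[OF I] by simp

lemma ideal_int_adjoin_scale: "x \<in> I \<Longrightarrow> of_int n * x \<in> I"
  using ideal_int_adjoin_mult[of x "[:n:]"] by simp

lemma ideal_int_adjoin_diff: "x \<in> I \<Longrightarrow> y \<in> I \<Longrightarrow> x - y \<in> I"
  using ideal_int_adjoin_add[of x "- y"] ideal_int_adjoin_scale[of y "-1"] by simp

lemma ideal_int_adjoin_coset_eq:
  "I +>\<^bsub>int_adjoin \<alpha>\<^esub> x = I +>\<^bsub>int_adjoin \<alpha>\<^esub> y \<longleftrightarrow> x - y \<in> I"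
proof -
  have mem: "z \<in> I +>\<^bsub>int_adjoin \<alpha>\<^esub> w \<longleftrightarrow> z - w \<in> I" for z w
    by (force simp: a_r_coset_def')
  show ?thesis
  proof
    assume "I +>\<^bsub>int_adjoin \<alpha>\<^esub> x = I +>\<^bsub>int_adjoin \<alpha>\<^esub> y"
    then show "x - y \<in> I"
      using mem[of x x] mem[of x y] ideal_int_adjoin_zero by simp
  next
    assume xy: "x - y \<in> I"
    have "z - x \<in> I \<longleftrightarrow> z - y \<in> I" for z
      using ideal_int_adjoin_add[OF _ xy, of "z - x"] ideal_int_adjoin_diff[OF _ xy, of "z - y"]
      by auto
    then show "I +>\<^bsub>int_adjoin \<alpha>\<^esub> x = I +>\<^bsub>int_adjoin \<alpha>\<^esub> y"
      by (simp add: set_eq_iff mem)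
  qed
qed

text \<open>The quotient map is a homomorphism of additive groups, so powers of a coset are the
  cosets of integer multiples, and equality of cosets becomes a difference in
  \<open>I\<close>.\<close>

lemma cyclic_quotient_int_adjoin_iff:
  "cyclic_group (int_adjoin \<alpha> A_Mod I) \<longleftrightarrow>
     (\<exists>g. \<forall>p. \<exists>n. int_eval \<alpha> p - of_int n * int_eval \<alpha> g \<in> I)"
proof -
  let ?R = "int_adjoin \<alpha>" and ?Q = "int_adjoin \<alpha> A_Mod I"
  interpret I: ideal I ?R by (rule I)
  have carrier: "carrier ?Q = range (\<lambda>p. I +>\<^bsub>?R\<^esub> int_eval \<alpha> p)"
    by (auto simp: A_FactGroup_def FactGroup_def RCOSETS_def a_r_coset_def)
  have pow: "(I +>\<^bsub>?R\<^esub> int_eval \<alpha> g) [^]\<^bsub>?Q\<^esub> (n::int) = I +>\<^bsub>?R\<^esub> (of_int n * int_eval \<alpha> g)"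
    for g n
  proof -
    interpret h: group_hom "add_monoid ?R" ?Q "(+>\<^bsub>?R\<^esub>) I"
      by (intro group_hom.intro group_hom_axioms.intro I.a_group I.a_factorgroup_is_group
          I.a_r_coset_hom_A_Mod)
    show ?thesis
      using h.hom_int_pow[of "int_eval \<alpha> g" n] int_adjoin_additive_pow[of "int_eval \<alpha> g" \<alpha> n]
      by simp
  qed
  have in_carrier: "I +>\<^bsub>?R\<^esub> (of_int n * int_eval \<alpha> g) \<in> carrier ?Q" for n g
    using carrier by (auto simp flip: int_eval_smult)
  have "cyclic_group ?Q \<longleftrightarrow>
      (\<exists>x \<in> carrier ?Q. carrier ?Q = range (\<lambda>n::int. x [^]\<^bsub>?Q\<^esub> n))"
    by (rule group.cyclic_group[OF I.a_factorgroup_is_group])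
  also have "\<dots> \<longleftrightarrow>
      (\<exists>g. carrier ?Q = range (\<lambda>n::int. I +>\<^bsub>?R\<^esub> (of_int n * int_eval \<alpha> g)))"
    by (simp add: carrier pow)
  also have "\<dots> \<longleftrightarrow>
      (\<exists>g. \<forall>p. \<exists>n::int. I +>\<^bsub>?R\<^esub> int_eval \<alpha> p = I +>\<^bsub>?R\<^esub> (of_int n * int_eval \<alpha> g))"
  proof (intro ex_cong1)
    fix g
    \<comment> \<open>The powers of a coset always stay in the quotient, so generation reduces to
      the other inclusion.\<close>
    have "range (\<lambda>n::int. I +>\<^bsub>?R\<^esub> (of_int n * int_eval \<alpha> g)) \<subseteq> carrier ?Q"
      using in_carrier by auto
    then have "carrier ?Q = range (\<lambda>n::int. I +>\<^bsub>?R\<^esub> (of_int n * int_eval \<alpha> g)) \<longleftrightarrow>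
        carrier ?Q \<subseteq> range (\<lambda>n::int. I +>\<^bsub>?R\<^esub> (of_int n * int_eval \<alpha> g))"
      by blast
    then show "carrier ?Q = range (\<lambda>n::int. I +>\<^bsub>?R\<^esub> (of_int n * int_eval \<alpha> g)) \<longleftrightarrow>
        (\<forall>p. \<exists>n::int. I +>\<^bsub>?R\<^esub> int_eval \<alpha> p = I +>\<^bsub>?R\<^esub> (of_int n * int_eval \<alpha> g))"
      unfolding carrier by (simp add: image_subset_iff) (simp add: image_iff)
  qed
  finally show ?thesis by (simp add: ideal_int_adjoin_coset_eq)
qed

text \<open>If \<open>g\<close> generates the quotient, \<open>1 \<equiv> k g\<close> and \<open>g\<^sup>2 \<equiv> l g\<close>, then
  \<open>g \<equiv> k g\<^sup>2 \<equiv> l (k g) \<equiv> l\<close>, so that \<open>1\<close> generates as well.\<close>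

lemma cyclic_quotient_generated_by_one:
  assumes "cyclic_group (int_adjoin \<alpha> A_Mod I)"
  obtains n :: int where "int_eval \<alpha> p - of_int n \<in> I"
proof -
  obtain g where g: "\<And>p. \<exists>n. int_eval \<alpha> p - of_int n * int_eval \<alpha> g \<in> I"
    using assms cyclic_quotient_int_adjoin_iff by auto
  let ?g = "int_eval \<alpha> g"
  obtain k where k: "1 - of_int k * ?g \<in> I" using g[of 1] by auto
  obtain l where l: "?g * ?g - of_int l * ?g \<in> I" using g[of "g * g"] by auto
  obtain j where j: "int_eval \<alpha> p - of_int j * ?g \<in> I" using g by blast
  have "?g * (1 - of_int k * ?g) + of_int k * (?g * ?g - of_int l * ?g)
      - of_int l * (1 - of_int k * ?g) \<in> I"
    by (intro ideal_int_adjoin_add ideal_int_adjoin_diff ideal_int_adjoin_mult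
        ideal_int_adjoin_scale k l)
  then have "?g - of_int l \<in> I" by (simp add: algebra_simps)
  then have "(int_eval \<alpha> p - of_int j * ?g) + of_int j * (?g - of_int l) \<in> I"
    by (intro ideal_int_adjoin_add ideal_int_adjoin_scale j)
  then have "int_eval \<alpha> p - of_int (j * l) \<in> I" by (simp add: algebra_simps)
  then show thesis by (rule that)
qed

end

section \<open>Roots of monic irreducible polynomials\<close>

text \<open>Take a nonzero polynomial \<open>h\<close> of least degree in the ideal generated by \<open>F\<close> and \<open>p\<close>.
  Pseudo-division shows that \<open>h\<close> divides nonzero multiples \<open>c F\<close> and \<open>c' p\<close>; as \<open>F\<close> is prime,
  \<open>h\<close> must be constant.\<close>

lemma irreducible_int_poly_bezout:
  fixes F p :: "int poly"
  assumes irr: "Factorial_Ring.irreducible F" and deg: "degree F > 0" and ndvd: "\<not> F dvd p"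
  obtains u v c where "c \<noteq> 0" "u * F + v * p = [:c:]"
proof -
  define J where "J = {u * F + v * p | u v. True}"
  have prime: "prime_elem F"
    using irr by (rule irreducible_imp_prime_elem)
  have "F \<noteq> 0" using deg by auto
  have const: "\<not> F dvd [:c:]" if "c \<noteq> 0" for c
    using that deg by (auto dest!: dvd_imp_degree_le)
  have FJ: "F \<in> J" unfolding J_def by (rule CollectI, rule exI[of _ 1], rule exI[of _ 0]) simp
  have pJ: "p \<in> J" unfolding J_def by (rule CollectI, rule exI[of _ 0], rule exI[of _ 1]) simp
  obtain h where h: "h \<in> J" "h \<noteq> 0" and min: "\<And>r. r \<in> J \<Longrightarrow> r \<noteq> 0 \<Longrightarrow> degree h \<le> degree r"
    using ex_has_least_nat[of "\<lambda>r. r \<in> J \<and> r \<noteq> 0" F degree] FJ \<open>F \<noteq> 0\<close> by auto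
  have dvd: "\<exists>a. a \<noteq> 0 \<and> h dvd Polynomial.smult a f" if "f \<in> J" for f
  proof -
    obtain a q where aq: "a \<noteq> 0" "Polynomial.smult a f = h * q + pseudo_mod f h"
      using pseudo_mod(1)[OF h(2), of f] by auto
    obtain u v u' v' where "f = u * F + v * p" "h = u' * F + v' * p"
      using \<open>f \<in> J\<close> h(1) by (auto simp: J_def)
    then have "pseudo_mod f h = (Polynomial.smult a u - q * u') * F + (Polynomial.smult a v - q * v') * p"
      using aq(2) by (simp add: algebra_simps smult_add_right)
    then have "pseudo_mod f h \<in> J" by (auto simp: J_def)
    then have "pseudo_mod f h = 0"
      using pseudo_mod(2)[OF h(2), of f] min[of "pseudo_mod f h"] by force
    then show ?thesis using aq by auto
  qed
  obtain a k where a: "a \<noteq> 0" "Polynomial.smult a F = h * k"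
    using dvd[OF FJ] by (auto simp: dvd_def)
  \<comment> \<open>If \<open>F\<close> divided \<open>h\<close>, it would divide
    \<open>[:b:] * p\<close>; being prime, it would divide the nonzero constant or
    \<open>p\<close>.\<close>
  have "\<not> F dvd h"
  proof
    assume "F dvd h"
    moreover obtain b where b: "b \<noteq> 0" "h dvd Polynomial.smult b p" using dvd[OF pJ] by auto
    ultimately have "F dvd [:b:] * p" by (auto intro: dvd_trans)
    then show False
      using prime_elem_dvd_multD[OF prime] const[OF b(1)] ndvd by blast
  qed
  moreover have "F dvd h * k" unfolding a(2)[symmetric] by (simp add: dvd_smult)
  ultimately obtain k' where "k = F * k'"
    using prime_elem_dvd_multD[OF prime] by blast
  \<comment> \<open>Cancelling \<open>F\<close> exhibits \<open>h\<close> as a factor of the nonzero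
    constant \<open>[:a:]\<close>, which forces degree 0.\<close>
  then have "F * [:a:] = F * (h * k')"
    using a(2) by (simp add: mult_ac)
  then have "[:a:] = h * k'" using \<open>F \<noteq> 0\<close> by (simp only: mult_cancel_left) simp
  moreover from this have "k' \<noteq> 0" using a(1) by auto
  ultimately have "degree h = 0"
    using degree_mult_eq[OF h(2), of k'] by (metis add_is_0 degree_pCons_0)
  then obtain c where "h = [:c:]" by (rule degree_eq_zeroE)
  then show thesis using h that by (auto simp: J_def)
qed

section \<open>Evaluation at \<alpha> and its kernel\<close>

locale monic_irreducible_root =
  fixes F :: "int poly" and \<alpha> :: "'a::field_char_0"
  assumes degree_pos: "degree F > 0"
    and monic: "lead_coeff F = 1"
    and irreducible: "Factorial_Ring.irreducible F"
    and root: "int_eval \<alpha> F = 0"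
begin

text \<open>Evaluating the Bezout identity at \<alpha> kills the multiple of \<open>F\<close>.
  Consequently every nonzero ideal contains a nonzero integer.\<close>

lemma int_eval_ne_0_bezout:
  assumes "int_eval \<alpha> p \<noteq> 0"
  obtains v c where "c \<noteq> 0" "int_eval \<alpha> v * int_eval \<alpha> p = of_int c"
proof -
  have "\<not> F dvd p" using assms root by auto
  then obtain u v c where c: "c \<noteq> 0" "u * F + v * p = [:c:]"
    using irreducible_int_poly_bezout irreducible degree_pos by metis
  have "int_eval \<alpha> (u * F + v * p) = of_int c" by (simp only: c(2) int_eval_const)
  then show thesis using that c(1) root by simp
qed

text \<open>If \<open>F\<close> did not divide \<open>p\<close>, the Bezout identity at \<alpha>
  would make a nonzero integer vanish in characteristic 0. Equalities in \<int>[\<alpha>] thus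
  become congruences modulo \<open>F\<close>.\<close>

lemma int_eval_eq_0_iff: "int_eval \<alpha> p = 0 \<longleftrightarrow> F dvd p"
proof
  assume p: "int_eval \<alpha> p = 0"
  show "F dvd p"
  proof (rule ccontr)
    assume "\<not> F dvd p"
    then obtain u v c where c: "c \<noteq> 0" "u * F + v * p = [:c:]"
      using irreducible_int_poly_bezout irreducible degree_pos by metis
    have "int_eval \<alpha> (u * F + v * p) = of_int c" by (simp only: c(2) int_eval_const)
    then show False using c(1) root p by simp
  qed
qed (use root in auto)

text \<open>Pseudo-division scales \<open>p\<close> by a power of the leading coefficient of
  \<open>F\<close>; as that is 1, it is genuine division over the integers.\<close>

lemma reduce_degree:
  obtains q r where "p = F * q + r" "degree r < degree F"
proof -
  have "F \<noteq> 0" using degree_pos by auto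
  obtain q r where qr: "pseudo_divmod p F = (q, r)" by force
  have "p = F * q + r"
    using pseudo_divmod(1)[OF \<open>F \<noteq> 0\<close> qr] monic by simp
  moreover have "degree r < degree F"
    using pseudo_divmod(2)[OF \<open>F \<noteq> 0\<close> qr] degree_pos by auto
  ultimately show thesis by (rule that)
qed

section \<open>The ideal attached to \<open>m\<close> and \<mu>\<close>

text \<open>When \<open>m\<close> divides F(\<mu>), this is the kernel of the ring homomorphism from
  \<int>[\<alpha>] to the integers modulo \<open>m\<close> that sends \<alpha> to \<mu>.\<close>

definition root_lattice :: "int \<Rightarrow> int \<Rightarrow> 'a set" where
  "root_lattice m \<mu> = {int_eval \<alpha> p | p. m dvd poly p \<mu>}"

text \<open>The definition asks only for some representing polynomial. Two representatives differ by
  a multiple of \<open>F\<close>, whose value at \<mu> is divisible by \<open>m\<close>, so the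
  choice does not matter.\<close>

lemma int_eval_mem_root_lattice:
  assumes "m dvd poly F \<mu>"
  shows "int_eval \<alpha> p \<in> root_lattice m \<mu> \<longleftrightarrow> m dvd poly p \<mu>"
proof
  assume "int_eval \<alpha> p \<in> root_lattice m \<mu>"
  then obtain q where q: "int_eval \<alpha> p = int_eval \<alpha> q" "m dvd poly q \<mu>"
    by (auto simp: root_lattice_def)
  then have "F dvd p - q" by (simp flip: int_eval_eq_0_iff)
  then obtain k where "p = F * k + q" by (metis dvdE diff_add_cancel)
  then show "m dvd poly p \<mu>" using q(2) assms by simp
qed (auto simp: root_lattice_def)

lemma ideal_root_lattice: "ideal (root_lattice m \<mu>) (int_adjoin \<alpha>)"
proof (rule idealI[OF ring_int_adjoin])
  interpret G: group "add_monoid (int_adjoin \<alpha>)"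
    by (rule abelian_group.a_group[OF abelian_group_int_adjoin])
  have closed: "int_eval \<alpha> p \<in> root_lattice m \<mu>" if "m dvd poly p \<mu>" for p
    using that by (auto simp: root_lattice_def)
  show "subgroup (root_lattice m \<mu>) (add_monoid (int_adjoin \<alpha>))"
  proof (rule G.subgroupI)
    show "root_lattice m \<mu> \<noteq> {}" using closed[of 0] by auto
  next
    fix x assume "x \<in> root_lattice m \<mu>"
    then obtain p where p: "x = int_eval \<alpha> p" "m dvd poly p \<mu>" by (auto simp: root_lattice_def)
    have "inv\<^bsub>add_monoid (int_adjoin \<alpha>)\<^esub> x = int_eval \<alpha> (- p)"
      by (rule G.inv_equality) (simp_all add: p del: int_eval_uminus, simp)
    then show "inv\<^bsub>add_monoid (int_adjoin \<alpha>)\<^esub> x \<in> root_lattice m \<mu>"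
      using closed[of "- p"] p by simp
  next
    fix x y assume "x \<in> root_lattice m \<mu>" "y \<in> root_lattice m \<mu>"
    then obtain p q where "x = int_eval \<alpha> p" "m dvd poly p \<mu>" "y = int_eval \<alpha> q" "m dvd poly q \<mu>"
      by (auto simp: root_lattice_def)
    then show "x \<otimes>\<^bsub>add_monoid (int_adjoin \<alpha>)\<^esub> y \<in> root_lattice m \<mu>"
      using closed[of "p + q"] by simp
  qed (auto simp: root_lattice_def)
next
  fix a x assume "a \<in> root_lattice m \<mu>" "x \<in> carrier (int_adjoin \<alpha>)"
  then obtain p q where "a = int_eval \<alpha> p" "m dvd poly p \<mu>" "x = int_eval \<alpha> q"
    by (auto simp: root_lattice_def)
  then have "x * a \<in> root_lattice m \<mu>"
    unfolding root_lattice_def by (auto intro!: exI[of _ "q * p"])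
  then show "x \<otimes>\<^bsub>int_adjoin \<alpha>\<^esub> a \<in> root_lattice m \<mu>" "a \<otimes>\<^bsub>int_adjoin \<alpha>\<^esub> x \<in> root_lattice m \<mu>"
    by (simp_all add: mult.commute)
qed

text \<open>Subtracting the integer p(\<mu>) from \<open>p\<close> gives a polynomial vanishing at
  \<mu>, so every class contains an integer and 1 generates the quotient.\<close>

lemma cyclic_quotient_root_lattice: "cyclic_group (int_adjoin \<alpha> A_Mod root_lattice m \<mu>)"
proof -
  have "int_eval \<alpha> (p - [:poly p \<mu>:]) \<in> root_lattice m \<mu>" for p
    unfolding root_lattice_def by (intro CollectI exI[of _ "p - [:poly p \<mu>:]"] conjI refl) simp
  then have "int_eval \<alpha> p - of_int (poly p \<mu>) * int_eval \<alpha> 1 \<in> root_lattice m \<mu>" for p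
    by simp
  then show ?thesis
    unfolding cyclic_quotient_int_adjoin_iff[OF ideal_root_lattice] by blast
qed

section \<open>Ideals with cyclic quotient: existence and uniqueness of \<open>m\<close> and
  \<mu>\<close>

lemma cyclic_quotient_eq_root_lattice:
  assumes I: "ideal I (int_adjoin \<alpha>)" and "I \<noteq> {0}"
    and cyclic: "cyclic_group (int_adjoin \<alpha> A_Mod I)"
  obtains m \<mu> where "m > 0" "m dvd poly F \<mu>" "I = root_lattice m \<mu>"
proof -
  note add = ideal_int_adjoin_add[OF I] and diff = ideal_int_adjoin_diff[OF I]
    and mult = ideal_int_adjoin_mult[OF I] and scale = ideal_int_adjoin_scale[OF I]
    and zero = ideal_int_adjoin_zero[OF I]
  obtain x where "x \<in> I" "x \<noteq> 0" using \<open>I \<noteq> {0}\<close> zero by auto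
  then obtain p where p: "int_eval \<alpha> p \<in> I" "int_eval \<alpha> p \<noteq> 0"
    using ideal_int_adjoin_subset[OF I] by blast
  obtain c where c: "c \<noteq> 0" "(of_int c :: 'a) \<in> I"
    using int_eval_ne_0_bezout[OF p(2)] mult[OF p(1)] by metis
  \<comment> \<open>Phrased over the naturals so that \<open>LEAST\<close> applies; the absolute
    value of \<open>c\<close> is a witness because \<open>I\<close> is closed under
    negation.\<close>
  define P where "P n \<longleftrightarrow> n > 0 \<and> (of_nat n :: 'a) \<in> I" for n
  have "P (nat \<bar>c\<bar>)"
    using c scale[OF c(2), of "-1"] by (cases "c > 0") (auto simp: P_def)
  define m where "m = int (LEAST n. P n)"
  have Pm: "P (nat m)" unfolding m_def using \<open>P (nat \<bar>c\<bar>)\<close> by (simp add: LeastI)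
  then have m: "m > 0" "(of_int m :: 'a) \<in> I" by (auto simp: P_def)
  \<comment> \<open>Division with remainder: if \<open>n\<close> lies in \<open>I\<close>, so does
    \<open>n mod m\<close>, which is below \<open>m\<close> and hence 0 by minimality.\<close>
  have dvd: "(of_int n :: 'a) \<in> I \<longleftrightarrow> m dvd n" for n
  proof
    assume "(of_int n :: 'a) \<in> I"
    then have "of_int n - of_int (n div m) * of_int m \<in> I"
      using m(2) by (intro diff scale)
    then have "(of_int (n mod m) :: 'a) \<in> I"
      by (simp add: minus_div_mult_eq_mod flip: of_int_mult of_int_diff)
    moreover have "0 \<le> n mod m" "n mod m < m" using m(1) by simp_all
    ultimately have "\<not> P (nat (n mod m))" and "(of_nat (nat (n mod m)) :: 'a) \<in> I"
      unfolding m_def by (auto intro!: not_less_Least)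
    then show "m dvd n"
      using \<open>0 \<le> n mod m\<close> by (auto simp: P_def)
  next
    assume "m dvd n"
    then show "(of_int n :: 'a) \<in> I"
      using scale[OF m(2)] by (auto simp: mult.commute)
  qed
  \<comment> \<open>Since 1 generates the quotient, the class of \<alpha>, the value of X, contains
    an integer.\<close>
  obtain \<mu> where "int_eval \<alpha> [:0, 1:] - of_int \<mu> \<in> I"
    by (rule cyclic_quotient_generated_by_one[OF I cyclic])
  then have \<mu>: "int_eval \<alpha> [:- \<mu>, 1:] \<in> I"
    by (simp add: int_eval_def map_poly_pCons)
  \<comment> \<open>X - \<mu> divides q - q(\<mu>), and its value at \<alpha> lies in
    \<open>I\<close>.\<close>
  have cong: "int_eval \<alpha> q - of_int (poly q \<mu>) \<in> I" for q
  proof -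
    have "[:- \<mu>, 1:] dvd q - [:poly q \<mu>:]"
      by (simp flip: poly_eq_0_iff_dvd)
    then obtain r where r: "q - [:poly q \<mu>:] = r * [:- \<mu>, 1:]"
      by (auto simp: dvd_def mult.commute)
    have "int_eval \<alpha> (q - [:poly q \<mu>:]) \<in> I"
      unfolding r int_eval_mult using \<mu> by (rule mult)
    then show ?thesis by simp
  qed
  have mem: "int_eval \<alpha> q \<in> I \<longleftrightarrow> m dvd poly q \<mu>" for q
    using add[OF cong[of q], of "of_int (poly q \<mu>)"] diff[OF _ cong[of q], of "int_eval \<alpha> q"]
    by (auto simp flip: dvd)
  show thesis
  proof (rule that)
    show "m > 0" by (rule m(1))
    show "m dvd poly F \<mu>" using mem[of F] root zero by simp
    show "I = root_lattice m \<mu>"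
      unfolding root_lattice_def using mem ideal_int_adjoin_subset[OF I] by blast
  qed
qed

text \<open>Membership is tested on chosen polynomials: the constants \<open>m\<close> and
  \<open>m'\<close> give divisibility both ways, and X - \<mu> vanishes at \<mu> while taking the
  value \<mu>' - \<mu> at \<mu>'.\<close>

lemma root_lattice_eq_imp:
  assumes "m > 0" "m dvd poly F \<mu>" "m' > 0" "m' dvd poly F \<mu>'"
    and eq: "root_lattice m \<mu> = root_lattice m' \<mu>'"
  shows "m' = m" "[\<mu>' = \<mu>] (mod m)"
proof -
  have iff: "m dvd poly p \<mu> \<longleftrightarrow> m' dvd poly p \<mu>'" for p
    using int_eval_mem_root_lattice eq assms by metis
  show "m' = m"
    using iff[of "[:m:]"] iff[of "[:m':]"] assms by (intro zdvd_antisym_nonneg) auto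
  then show "[\<mu>' = \<mu>] (mod m)"
    using iff[of "[:- \<mu>, 1:]"] by (simp add: cong_iff_dvd_diff)
qed

section \<open>The \<int>-basis of the lattice and its matrix form\<close>

lemma is_int_basis_root_basis:
  assumes "m > 0" "m dvd poly F \<mu>"
  shows "is_int_basis (degree F) (root_basis (degree F) \<alpha> m \<mu>) (root_lattice m \<mu>)"
proof -
  let ?d = "degree F"
  let ?b = "root_basis ?d \<alpha> m \<mu>"
  interpret M: Modules.module "int_scale :: int \<Rightarrow> 'a \<Rightarrow> 'a"
    by (rule module_int_scale)
  \<comment> \<open>\<open>B\<close> lifts the family to polynomials of degree below
    \<open>?d\<close>, where relations can be compared coefficientwise.\<close>
  define B where "B i = (if i < ?d - 1 then monom 1 (?d - 1 - i) - [:\<mu> ^ (?d - 1 - i):] else [:m:])"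
    for i
  have b: "?b i = int_eval \<alpha> (B i)" for i
    by (simp add: root_basis_def B_def)
  have indep: "c i = 0" if sum: "(\<Sum>i<?d. of_int (c i) * ?b i) = 0" and "i < ?d" for c :: "nat \<Rightarrow> int" and i
  proof -
    \<comment> \<open>The lifted relation is divisible by \<open>F\<close> but has smaller degree,
      so it is zero as a polynomial.\<close>
    define P where "P = (\<Sum>i<?d. Polynomial.smult (c i) (B i))"
    have "int_eval \<alpha> P = 0" using sum by (simp add: P_def b)
    then have "F dvd P" by (simp add: int_eval_eq_0_iff)
    moreover have "degree (B i) < ?d" for i
      unfolding B_def using degree_pos by (auto intro!: degree_diff_less simp: degree_monom_eq)
    then have "degree P < ?d"
      unfolding P_def using degree_pos
      by (intro degree_sum_less) (simp_all add: degree_smult_eq)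
    ultimately have "P = 0" using dvd_imp_degree_le[of F P] by auto
    \<comment> \<open>The exponent is positive here, so constant terms do not contribute and only
      \<open>B j\<close> does.\<close>
    have coeff: "coeff P (?d - 1 - j) = c j" if "j < ?d - 1" for j
    proof -
      have "coeff P (?d - 1 - j) = (\<Sum>i<?d. if i = j then c i else 0)"
        unfolding P_def coeff_sum using that
        by (intro sum.cong) (auto simp: B_def coeff_pCons split: nat.splits)
      then show ?thesis using that by simp
    qed
    have c: "c j = 0" if "j < ?d - 1" for j
      using coeff[OF that] \<open>P = 0\<close> by simp
    \<comment> \<open>With the other coefficients gone, \<open>P\<close> is the constant
      \<open>c (?d - 1) * m\<close>.\<close>
    have "P = (\<Sum>i\<in>{?d - 1}. Polynomial.smult (c i) (B i))"
      unfolding P_def using degree_pos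
      by (intro sum.mono_neutral_right) (auto simp: c)
    then have "c (?d - 1) = 0" using \<open>P = 0\<close> \<open>m > 0\<close> by (simp add: B_def)
    then show ?thesis using c[of i] \<open>i < ?d\<close> by (cases "i = ?d - 1") auto
  qed
  have inj: "inj_on ?b {..<?d}"
  proof (rule inj_onI, rule ccontr)
    fix i j assume ij: "i \<in> {..<?d}" "j \<in> {..<?d}" "?b i = ?b j" "i \<noteq> j"
    \<comment> \<open>A repeated entry would yield a relation with coefficients 1 and -1.\<close>
    define c :: "nat \<Rightarrow> int" where "c k = (if k = i then 1 else if k = j then - 1 else 0)" for k
    have "(\<Sum>k<?d. of_int (c k) * ?b k) = (\<Sum>k\<in>{i, j}. of_int (c k) * ?b k)"
      using ij by (intro sum.mono_neutral_right) (auto simp: c_def)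
    also have "\<dots> = 0" using ij by (simp add: c_def)
    finally show False using indep[of c i] ij by (simp add: c_def)
  qed
  have "\<not> M.dependent (?b ` {..<?d})"
    by (subst M.dependent_finite) (auto simp: sum.reindex[OF inj] int_scale_def dest: indep)
  moreover have "M.span (?b ` {..<?d}) = root_lattice m \<mu>"
  proof
    have B: "m dvd poly (B i) \<mu>" for i by (simp add: B_def poly_monom)
    have "?b ` {..<?d} \<subseteq> root_lattice m \<mu>"
      using B b by (auto simp: root_lattice_def)
    moreover have "M.subspace (root_lattice m \<mu>)"
      using ideal_root_lattice[of m \<mu>]
      by (intro M.subspaceI)
        (simp_all add: int_scale_def ideal_int_adjoin_zero ideal_int_adjoin_add ideal_int_adjoin_scale)
    ultimately show "M.span (?b ` {..<?d}) \<subseteq> root_lattice m \<mu>"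
      by (rule M.span_minimal)
  next
    show "root_lattice m \<mu> \<subseteq> M.span (?b ` {..<?d})"
    proof
      fix x assume "x \<in> root_lattice m \<mu>"
      then obtain p where p: "x = int_eval \<alpha> p" "m dvd poly p \<mu>" by (auto simp: root_lattice_def)
      \<comment> \<open>Reduction modulo \<open>F\<close> leaves the value at \<alpha> unchanged
        and, as \<open>m\<close> divides F(\<mu>), preserves divisibility at \<mu>; only powers
        below \<open>?d\<close> remain.\<close>
      obtain q r where r: "p = F * q + r" "degree r < ?d" by (rule reduce_degree)
      have "m dvd poly r \<mu>"
        using p(2) r(1) assms(2) by (simp add: dvd_add_right_iff)
      then obtain s where s: "poly r \<mu> = m * s" by (rule dvdE)
      have mem: "of_int n * ?b i \<in> M.span (?b ` {..<?d})" if "i < ?d" for n i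
        using M.span_scale[OF M.span_base, of "?b i" _ n] that by (simp add: int_scale_def)
      \<comment> \<open>Exponent \<open>k\<close> sits at index \<open>?d - 1 - k\<close>, except
        for \<open>k = 0\<close>: there the difference is 0 and the index belongs to
        \<open>m\<close>.\<close>
      have pow: "of_int n * (\<alpha> ^ k - of_int \<mu> ^ k) \<in> M.span (?b ` {..<?d})" if "k < ?d" for n k
      proof (cases "k = 0")
        case True
        then show ?thesis by (simp add: M.span_zero)
      next
        case False
        then have "?b (?d - 1 - k) = \<alpha> ^ k - of_int \<mu> ^ k"
          using that by (auto simp: root_basis_def)
        then show ?thesis using mem[of "?d - 1 - k" n] that by simp
      qed
      have const: "of_int s * of_int m \<in> M.span (?b ` {..<?d})"
        using mem[of "?d - 1" s] degree_pos by (simp add: root_basis_def)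
      have "x = int_eval \<alpha> r" using p(1) r(1) root by simp
      \<comment> \<open>Adding and subtracting r(\<mu>) turns each power into a difference and
        leaves an integer that is a multiple of \<open>m\<close>.\<close>
      also have "\<dots> = (\<Sum>k\<le>degree r. of_int (coeff r k) * (\<alpha> ^ k - of_int \<mu> ^ k))
          + of_int (poly r \<mu>)"
        by (simp add: int_eval_sum_coeff poly_altdef sum_subtractf algebra_simps)
      also have "\<dots> = (\<Sum>k\<le>degree r. of_int (coeff r k) * (\<alpha> ^ k - of_int \<mu> ^ k))
          + of_int s * of_int m"
        by (simp add: s)
      also have "\<dots> \<in> M.span (?b ` {..<?d})"
        using r(2) by (intro M.span_add M.span_sum pow const) auto
      finally show "x \<in> M.span (?b ` {..<?d})" .
    qed
  qed
  ultimately show ?thesis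
    using inj by (simp add: is_int_basis_def int_span_def)
qed

end

text \<open>The columns before the last pick out the power of \<alpha>; the last column meets
  \<alpha>^0 = 1 and contributes the constant.\<close>

lemma matrix_basis_eq_root_basis:
  fixes \<alpha> :: "'a::field_char_0"
  assumes "i < d"
  shows "matrix_basis d \<alpha> m \<mu> i = root_basis d \<alpha> m \<mu> i"
proof -
  let ?r = "\<lambda>j. of_int (if j < d - 1 then if i = j then 1 else 0
      else if i < d - 1 then - (\<mu> ^ (d - 1 - i)) else m) :: 'a"
  obtain e where e: "d = Suc e" using assms by (cases d) auto
  have "matrix_basis d \<alpha> m \<mu> i = (\<Sum>j<d. ?r j * \<alpha> ^ (d - 1 - j))"
    using assms
    by (auto simp: matrix_basis_def root_matrix_def power_vec_def scalar_prod_def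
        atLeast0LessThan intro!: sum.cong)
  also have "\<dots> = (\<Sum>j<e. if i = j then \<alpha> ^ (e - j) else 0)
      + (if i < e then - (of_int \<mu> ^ (e - i)) else of_int m)"
    by (auto simp: e if_distrib[of of_int] if_distrib[of "\<lambda>x. x * _"] cong: if_cong)
  also have "\<dots> = root_basis d \<alpha> m \<mu> i"
    using assms by (auto simp: root_basis_def e)
  finally show ?thesis .
qed

lemma is_int_basis_cong:
  assumes "\<And>i. i < d \<Longrightarrow> b i = b' i"
  shows "is_int_basis d b M \<longleftrightarrow> is_int_basis d b' M"
proof -
  have "inj_on b {..<d} \<longleftrightarrow> inj_on b' {..<d}" "b ` {..<d} = b' ` {..<d}"
    using assms by (auto intro!: inj_on_cong image_cong)
  then show ?thesis by (simp add: is_int_basis_def)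
qed

theorem theorem1:
  fixes F :: "int poly" and d :: nat and \<alpha> :: "'a::field_char_0"
  assumes "d \<ge> 2"
    and "degree F = d"
    and "lead_coeff F = 1"
    and "Factorial_Ring.irreducible F"
    and "poly (map_poly of_int F) \<alpha> = 0"
  shows
    "(\<forall>I. ideal I (int_adjoin \<alpha>) \<and> I \<noteq> {0} \<and> cyclic_group (int_adjoin \<alpha> A_Mod I) \<longrightarrow>
        (\<exists>m \<mu>. m > 0 \<and> [poly F \<mu> = 0] (mod m) \<and> is_int_basis d (root_basis d \<alpha> m \<mu>) I) \<and>
        (\<forall>m \<mu>. m > 0 \<and> [poly F \<mu> = 0] (mod m) \<longrightarrow>
           (is_int_basis d (root_basis d \<alpha> m \<mu>) I \<longleftrightarrow> is_int_basis d (matrix_basis d \<alpha> m \<mu>) I)) \<and>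
        (\<forall>m \<mu> m' \<mu>'.
           m > 0 \<and> [poly F \<mu> = 0] (mod m) \<and> is_int_basis d (root_basis d \<alpha> m \<mu>) I \<and>
           m' > 0 \<and> [poly F \<mu>' = 0] (mod m') \<and> is_int_basis d (root_basis d \<alpha> m' \<mu>') I \<longrightarrow>
           m' = m \<and> [\<mu>' = \<mu>] (mod m))) \<and>
     (\<forall>m \<mu>. m > 0 \<and> [poly F \<mu> = 0] (mod m) \<longrightarrow>
        (let I = int_span (root_basis d \<alpha> m \<mu> ` {..<d}) in
           is_int_basis d (root_basis d \<alpha> m \<mu>) I \<and>
           ideal I (int_adjoin \<alpha>) \<and>
           cyclic_group (int_adjoin \<alpha> A_Mod I)))"
proof -
  interpret monic_irreducible_root F \<alpha>
    using assms by unfold_locales (auto simp: int_eval_def)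
  have basis: "is_int_basis d (root_basis d \<alpha> m \<mu>) (root_lattice m \<mu>)"
    if "m > 0" "m dvd poly F \<mu>" for m \<mu>
    using is_int_basis_root_basis[OF that] assms(2) by simp
  have span: "int_span (root_basis d \<alpha> m \<mu> ` {..<d}) = root_lattice m \<mu>"
    if "m > 0" "m dvd poly F \<mu>" for m \<mu>
    using basis[OF that] by (simp add: is_int_basis_def)
  have exists: "\<exists>m \<mu>. m > 0 \<and> m dvd poly F \<mu> \<and> is_int_basis d (root_basis d \<alpha> m \<mu>) I"
    if "ideal I (int_adjoin \<alpha>)" "I \<noteq> {0}" "cyclic_group (int_adjoin \<alpha> A_Mod I)" for I
    using cyclic_quotient_eq_root_lattice[OF that] basis by metis
  have matrix: "is_int_basis d (root_basis d \<alpha> m \<mu>) I \<longleftrightarrow> is_int_basis d (matrix_basis d \<alpha> m \<mu>) I"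
    for m \<mu> I
    by (rule is_int_basis_cong) (simp add: matrix_basis_eq_root_basis)
  have unique: "m' = m \<and> [\<mu>' = \<mu>] (mod m)"
    if "m > 0" "m dvd poly F \<mu>" "is_int_basis d (root_basis d \<alpha> m \<mu>) I"
      "m' > 0" "m' dvd poly F \<mu>'" "is_int_basis d (root_basis d \<alpha> m' \<mu>') I" for m \<mu> m' \<mu>' I
  proof -
    \<comment> \<open>Both families span \<open>I\<close>, and each span is the corresponding
      lattice.\<close>
    have "root_lattice m \<mu> = root_lattice m' \<mu>'"
      using that span[of m \<mu>] span[of m' \<mu>'] by (simp add: is_int_basis_def)
    then show ?thesis using root_lattice_eq_imp that by blast
  qed
  have converse: "let I = int_span (root_basis d \<alpha> m \<mu> ` {..<d}) in
      is_int_basis d (root_basis d \<alpha> m \<mu>) I \<and> ideal I (int_adjoin \<alpha>) \<and>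
      cyclic_group (int_adjoin \<alpha> A_Mod I)" if "m > 0" "m dvd poly F \<mu>" for m \<mu>
    using basis[OF that] ideal_root_lattice cyclic_quotient_root_lattice
    by (simp add: span[OF that] Let_def)
  \<comment> \<open>\<open>cong_0_iff\<close> turns the congruences on F(\<mu>) into the
    divisibilities used in the facts above.\<close>
  show ?thesis
    unfolding cong_0_iff
    by (intro conjI allI impI; (elim conjE)?)
      (rule exists matrix unique[THEN conjunct1] unique[THEN conjunct2] converse; assumption)+
qed

end
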